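(* Let $\mathcal{S}=(S,+,\cdot,0,1)$ be a DNL-semiring, let $n(x):=\sum_{x\cdot y=0}y$ for $x\in S$, and put $$x\wedge y:=n(n(x)+n(y))\quad\text{and}\quad x\rightarrow y:=n(x\cdot n(y))$$ for all $x,y\in S$. Then $\mathbf{L}(\mathcal{S}):=(S,+,\wedge,\cdot,\rightarrow,0,1)$ is a complete residuated lattice satisfying the double negation law.
   Context: A semiring is an algebra $(S,+,\cdot,0,1)$ of type $(2,2,0,0)$ such that $(S,+,0)$ is a commutative monoid, $(S,\cdot,1)$ is a monoid, $(x+y)\cdot z=x\cdot z+y\cdot z$ and $x\cdot(y+z)=x\cdot y+x\cdot z$, and $x\cdot 0=0\cdot x=0$, for all $x,y,z\in S$. It is called idempotent if $x+x=x$ for all $x$, commutative if $x\cdot y=y\cdot x$ for all $x,y$, and simple if $x+1=1$ for all $x$. If the semiring is idempotent, $(S,+)$ is a join-semilattice with induced order $a\leq b$ iff $a+b=b$, and $\sum$ over a family denotes its supremum with respect to $\leq$. A DNL-semiring is a commutative idempotent simple semiring $(S,+,\cdot,0,1)$ such that $(S,+)$ is a complete join-semilattice (every subset of $S$ has a supremum) and such that, with $n(x):=\sum_{x\cdot y=0}y$ (the supremum of $\{y\in S\mid x\cdot y=0\}$), the following hold for all $x,y\in S$: (i) $n(n(x))=x$; (ii) $x\cdot n(x\cdot n(y))\leq y$; (iii) $x\cdot n(x+y)=0$. A residuated lattice is an algebra $(L,\vee,\wedge,\odot,\rightarrow,0,1)$ of type $(2,2,2,2,0,0)$ such that $(L,\vee,\wedge,0,1)$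 is a bounded lattice (with least element $0$ and greatest element $1$), $(L,\odot,1)$ is a commutative monoid, and for all $x,y,z\in L$: $x\odot y\leq z$ if and only if $x\leq y\rightarrow z$, where $\leq$ is the lattice order. It is complete if its lattice is complete. With $\neg x:=x\rightarrow 0$, it satisfies the double negation law if $\neg(\neg x)=x$ for all $x\in L$. *)

theory Defs
  imports "HOL-Algebra.Ring" "HOL-Algebra.Complete_Lattice"
begin

definition join_order :: "'a set \<Rightarrow> ('a \<Rightarrow> 'a \<Rightarrow> 'a) \<Rightarrow> 'a gorder"
  where "join_order A j = \<lparr>carrier = A, eq = (=), le = (\<lambda>x y. j x y = y)\<rparr>"


subsection \<open>DNL-semirings\<close>

abbreviation semiring_order :: "('a, 'm) ring_scheme \<Rightarrow> 'a gorder"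
  where "semiring_order S \<equiv> join_order (carrier S) (add S)"

definition annihilator_sup :: "('a, 'm) ring_scheme \<Rightarrow> 'a \<Rightarrow> 'a" (\<open>\<nn>\<index>\<close>)
  where "annihilator_sup S x =
    \<Squnion>\<^bsub>semiring_order S\<^esub> {y \<in> carrier S. x \<otimes>\<^bsub>S\<^esub> y = \<zero>\<^bsub>S\<^esub>}"

text \<open>The library's \<^locale>\<open>semiring\<close> does not require \<open>\<zero> \<noteq> \<one>\<close>.  Existence of all suprema is
  assumed explicitly, so that the choice operator in \<^const>\<open>annihilator_sup\<close> denotes the
  actual supremum.\<close>

locale dnl_semiring = semiring S for S (structure) +
  assumes mult_commute: "\<lbrakk>x \<in> carrier S; y \<in> carrier S\<rbrakk> \<Longrightarrow> x \<otimes> y = y \<otimes> x"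
    and add_idem: "x \<in> carrier S \<Longrightarrow> x \<oplus> x = x"
    and simple: "x \<in> carrier S \<Longrightarrow> x \<oplus> \<one> = \<one>"
    and sup_exists: "A \<subseteq> carrier S \<Longrightarrow>
      \<exists>s. least (semiring_order S) s (Upper (semiring_order S) A)"
    and dnl1: "x \<in> carrier S \<Longrightarrow> \<nn> (\<nn> x) = x"
    and dnl2: "\<lbrakk>x \<in> carrier S; y \<in> carrier S\<rbrakk> \<Longrightarrow>
      x \<otimes> \<nn> (x \<otimes> \<nn> y) \<sqsubseteq>\<^bsub>semiring_order S\<^esub> y"
    and dnl3: "\<lbrakk>x \<in> carrier S; y \<in> carrier S\<rbrakk> \<Longrightarrow> x \<otimes> \<nn> (x \<oplus> y) = \<zero>"


subsection \<open>Residuated lattices\<close>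

text \<open>The monoid part of the record carries \<open>\<odot>\<close> (as \<open>\<otimes>\<close>) and the greatest element (as \<open>\<one>\<close>).\<close>

record 'a residuated = "'a monoid" +
  rjoin :: "['a, 'a] \<Rightarrow> 'a" (infixl \<open>\<curlyvee>\<index>\<close> 65)
  rmeet :: "['a, 'a] \<Rightarrow> 'a" (infixl \<open>\<curlywedge>\<index>\<close> 70)
  residuum :: "['a, 'a] \<Rightarrow> 'a" (infixr \<open>\<rightharpoonup>\<index>\<close> 60)
  rbot :: 'a (\<open>\<bbbO>\<index>\<close>)

abbreviation lattice_order :: "('a, 'm) residuated_scheme \<Rightarrow> 'a gorder"
  where "lattice_order L \<equiv> join_order (carrier L) (rjoin L)"

locale residuated_lattice = comm_monoid L for L (structure) +
  assumes join_closed: "\<lbrakk>x \<in> carrier L; y \<in> carrier L\<rbrakk> \<Longrightarrow> x \<curlyvee> y \<in> carrier L"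
    and meet_closed: "\<lbrakk>x \<in> carrier L; y \<in> carrier L\<rbrakk> \<Longrightarrow> x \<curlywedge> y \<in> carrier L"
    and residuum_closed: "\<lbrakk>x \<in> carrier L; y \<in> carrier L\<rbrakk> \<Longrightarrow> x \<rightharpoonup> y \<in> carrier L"
    and bot_closed: "\<bbbO> \<in> carrier L"
    and join_assoc: "\<lbrakk>x \<in> carrier L; y \<in> carrier L; z \<in> carrier L\<rbrakk> \<Longrightarrow>
      (x \<curlyvee> y) \<curlyvee> z = x \<curlyvee> (y \<curlyvee> z)"
    and meet_assoc: "\<lbrakk>x \<in> carrier L; y \<in> carrier L; z \<in> carrier L\<rbrakk> \<Longrightarrow>
      (x \<curlywedge> y) \<curlywedge> z = x \<curlywedge> (y \<curlywedge> z)"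
    and join_commute: "\<lbrakk>x \<in> carrier L; y \<in> carrier L\<rbrakk> \<Longrightarrow> x \<curlyvee> y = y \<curlyvee> x"
    and meet_commute: "\<lbrakk>x \<in> carrier L; y \<in> carrier L\<rbrakk> \<Longrightarrow> x \<curlywedge> y = y \<curlywedge> x"
    and join_meet_absorb: "\<lbrakk>x \<in> carrier L; y \<in> carrier L\<rbrakk> \<Longrightarrow> x \<curlyvee> (x \<curlywedge> y) = x"
    and meet_join_absorb: "\<lbrakk>x \<in> carrier L; y \<in> carrier L\<rbrakk> \<Longrightarrow> x \<curlywedge> (x \<curlyvee> y) = x"
    and bot_least: "x \<in> carrier L \<Longrightarrow> \<bbbO> \<sqsubseteq>\<^bsub>lattice_order L\<^esub> x"
    and one_greatest: "x \<in> carrier L \<Longrightarrow> x \<sqsubseteq>\<^bsub>lattice_order L\<^esub> \<one>"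
    and residuation: "\<lbrakk>x \<in> carrier L; y \<in> carrier L; z \<in> carrier L\<rbrakk> \<Longrightarrow>
      x \<otimes> y \<sqsubseteq>\<^bsub>lattice_order L\<^esub> z \<longleftrightarrow> x \<sqsubseteq>\<^bsub>lattice_order L\<^esub> y \<rightharpoonup> z"

locale complete_residuated_lattice = residuated_lattice L for L (structure) +
  assumes complete: "complete_lattice (lattice_order L)"

definition rneg :: "('a, 'm) residuated_scheme \<Rightarrow> 'a \<Rightarrow> 'a"
  where "rneg L x = x \<rightharpoonup>\<^bsub>L\<^esub> \<bbbO>\<^bsub>L\<^esub>"

definition double_negation_law :: "('a, 'm) residuated_scheme \<Rightarrow> bool"
  where "double_negation_law L \<longleftrightarrow> (\<forall>x \<in> carrier L. rneg L (rneg L x) = x)"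


subsection \<open>The algebra assigned to a DNL-semiring\<close>

definition residuated_of_semiring :: "('a, 'm) ring_scheme \<Rightarrow> 'a residuated"
  where "residuated_of_semiring S =
    \<lparr>carrier = carrier S,
     mult = mult S,
     one = one S,
     rjoin = add S,
     rmeet = (\<lambda>x y. \<nn>\<^bsub>S\<^esub> (\<nn>\<^bsub>S\<^esub> x \<oplus>\<^bsub>S\<^esub> \<nn>\<^bsub>S\<^esub> y)),
     residuum = (\<lambda>x y. \<nn>\<^bsub>S\<^esub> (x \<otimes>\<^bsub>S\<^esub> \<nn>\<^bsub>S\<^esub> y)),
     rbot = zero S\<rparr>"

end

theory Submission
  imports Defs
begin

text \<open>Axiom (iii) gives \<open>n (x + y) \<le> n x\<close>, so that with (i) the map \<open>n\<close> is an antitone involution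
  satisfying \<open>x \<cdot> n x = 0\<close>. Hence \<open>\<and>\<close> is the lattice meet by De Morgan. One half of residuation is
  (ii); for the other, \<open>x \<cdot> y \<le> z\<close> implies \<open>x \<cdot> y \<cdot> n z \<le> z \<cdot> n z = 0\<close>, that is,
  \<open>x \<le> n (y \<cdot> n z)\<close>.\<close>

context dnl_semiring
begin

abbreviation leq (infix \<open>\<preceq>\<close> 50)
  where "x \<preceq> y \<equiv> x \<oplus> y = y"

lemma leq_trans:
  "\<lbrakk>x \<preceq> y; y \<preceq> z; x \<in> carrier S; y \<in> carrier S; z \<in> carrier S\<rbrakk> \<Longrightarrow> x \<preceq> z"
  by (metis a_assoc)

lemma partial_order_semiring_order: "partial_order (semiring_order S)"
  by unfold_locales
    (auto simp: join_order_def add_idem intro: leq_trans, metis a_comm)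

text \<open>The supremum operator is a choice; \<open>sup_exists\<close> provides a witness, so the
  chosen element really is a least upper bound. The set lies in the carrier whatever
  \<open>x\<close> is, hence no assumption on \<open>x\<close>.\<close>

lemma least_annihilator_sup:
  "least (semiring_order S) (\<nn> x)
     (Upper (semiring_order S) {y \<in> carrier S. x \<otimes> y = \<zero>})"
  unfolding annihilator_sup_def sup_def
  by (rule someI_ex, rule sup_exists) blast

lemma annihilator_sup_closed [simp]: "\<nn> x \<in> carrier S"
  using least_annihilator_sup[of x] by (auto simp: least_def Upper_def join_order_def)

lemma annihilator_sup_upper:
  "\<lbrakk>y \<in> carrier S; x \<otimes> y = \<zero>\<rbrakk> \<Longrightarrow> y \<preceq> \<nn> x"
  using least_annihilator_sup[of x] by (auto simp: least_def Upper_def join_order_def)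

text \<open>Axiom (iii) with \<open>y = x\<close>. Thus the supremum is attained:
  \<open>\<nn> x\<close> is the greatest annihilator of \<open>x\<close>.\<close>

lemma mult_annihilator_sup: "x \<in> carrier S \<Longrightarrow> x \<otimes> \<nn> x = \<zero>"
  by (metis dnl3 add_idem)

text \<open>Here \<open>x \<oplus> y = y\<close>, so (iii) says that \<open>\<nn> y\<close>
  annihilates \<open>x\<close>.\<close>

lemma annihilator_sup_antimono:
  "\<lbrakk>x \<preceq> y; x \<in> carrier S; y \<in> carrier S\<rbrakk> \<Longrightarrow> \<nn> y \<preceq> \<nn> x"
  by (metis annihilator_sup_closed annihilator_sup_upper dnl3)

text \<open>\<open>\<one>\<close> annihilates \<open>\<zero>\<close>, and by simplicity nothing lies
  above \<open>\<one>\<close>.\<close>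

lemma annihilator_sup_zero: "\<nn> \<zero> = \<one>"
  by (metis annihilator_sup_closed annihilator_sup_upper l_null one_closed a_comm simple)

lemma mult_right_mono:
  "\<lbrakk>x \<preceq> y; x \<in> carrier S; y \<in> carrier S; z \<in> carrier S\<rbrakk> \<Longrightarrow> x \<otimes> z \<preceq> y \<otimes> z"
  by (metis l_distr)

lemma add_meet_absorb:
  assumes "x \<in> carrier S" "y \<in> carrier S"
  shows "x \<oplus> \<nn> (\<nn> x \<oplus> \<nn> y) = x"
proof -
  have "\<nn> x \<preceq> \<nn> x \<oplus> \<nn> y"
    by (simp add: a_assoc[symmetric] add_idem)
  then have "\<nn> (\<nn> x \<oplus> \<nn> y) \<preceq> x"
    using annihilator_sup_antimono[of "\<nn> x" "\<nn> x \<oplus> \<nn> y"] assms by (simp add: dnl1)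
  then show ?thesis
    using assms by (simp add: a_comm)
qed

lemma meet_add_absorb:
  assumes "x \<in> carrier S" "y \<in> carrier S"
  shows "\<nn> (\<nn> x \<oplus> \<nn> (x \<oplus> y)) = x"
proof -
  have "x \<preceq> x \<oplus> y"
    using assms by (simp add: a_assoc[symmetric] add_idem)
  \<comment> \<open>By antitonicity the join collapses to its larger term; (i) then returns
    \<open>x\<close>.\<close>
  then have "\<nn> x \<oplus> \<nn> (x \<oplus> y) = \<nn> x"
    using annihilator_sup_antimono[of x "x \<oplus> y"] assms by (simp add: a_comm)
  then show ?thesis
    using assms by (simp add: dnl1)
qed

lemma mult_leq_iff:
  assumes "x \<in> carrier S" "y \<in> carrier S" "z \<in> carrier S"
  shows "x \<otimes> y \<preceq> z \<longleftrightarrow> x \<preceq> \<nn> (y \<otimes> \<nn> z)"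
proof
  assume "x \<otimes> y \<preceq> z"
  then have "x \<otimes> y \<otimes> \<nn> z \<preceq> \<zero>"
    using mult_right_mono[of "x \<otimes> y" z "\<nn> z"] assms by (simp add: mult_annihilator_sup)
  \<comment> \<open>Being below \<open>\<zero>\<close> means being \<open>\<zero>\<close>. The
    factors are reordered to exhibit \<open>x\<close> as an annihilator of
    \<open>y \<otimes> \<nn> z\<close>.\<close>
  then have "y \<otimes> \<nn> z \<otimes> x = \<zero>"
    using assms by (simp add: m_assoc mult_commute[of x])
  then show "x \<preceq> \<nn> (y \<otimes> \<nn> z)"
    using assms by (simp add: annihilator_sup_upper)
next
  assume "x \<preceq> \<nn> (y \<otimes> \<nn> z)"
  then have "x \<otimes> y \<preceq> y \<otimes> \<nn> (y \<otimes> \<nn> z)"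
    using mult_right_mono[of x "\<nn> (y \<otimes> \<nn> z)" y] assms by (simp add: mult_commute[of _ y])
  moreover have "y \<otimes> \<nn> (y \<otimes> \<nn> z) \<preceq> z"
    using dnl2[of y z] assms by (simp add: join_order_def)
  ultimately show "x \<otimes> y \<preceq> z"
    using assms by (auto intro: leq_trans)
qed

text \<open>Suprema are given; the infimum of \<open>A\<close> is the supremum of its lower bounds,
  because each element of \<open>A\<close> is an upper bound of these.\<close>

lemma complete_lattice_semiring_order: "complete_lattice (semiring_order S)"
proof -
  interpret partial_order "semiring_order S"
    by (rule partial_order_semiring_order)
  have "\<exists>i. greatest (semiring_order S) i (Lower (semiring_order S) A)"
    if A: "A \<subseteq> carrier S" for A
  proof -
    have "Lower (semiring_order S) A \<subseteq> carrier S"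
      by (auto simp: Lower_def join_order_def)
    from sup_exists[OF this] obtain i
      where i: "least (semiring_order S) i
        (Upper (semiring_order S) (Lower (semiring_order S) A))" ..
    then have "greatest (semiring_order S) i (Lower (semiring_order S) A)"
      using A by (auto simp: least_def greatest_def Upper_def Lower_def join_order_def)
    then show ?thesis ..
  qed
  then show ?thesis
    by unfold_locales (auto simp: join_order_def intro: sup_exists[unfolded join_order_def])
qed

lemma residuated_lattice_residuated_of_semiring:
  "residuated_lattice (residuated_of_semiring S)"
proof (rule residuated_lattice.intro)
  show "comm_monoid (residuated_of_semiring S)"
    by (rule comm_monoidI) (simp_all add: residuated_of_semiring_def m_assoc, simp add: mult_commute)
  show "residuated_lattice_axioms (residuated_of_semiring S)"
  proof
    fix x y z
    assume "x \<in> carrier (residuated_of_semiring S)" "y \<in> carrier (residuated_of_semiring S)"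
      "z \<in> carrier (residuated_of_semiring S)"
    then show "(x \<otimes>\<^bsub>residuated_of_semiring S\<^esub> y
          \<sqsubseteq>\<^bsub>lattice_order (residuated_of_semiring S)\<^esub> z) =
        (x \<sqsubseteq>\<^bsub>lattice_order (residuated_of_semiring S)\<^esub>
          y \<rightharpoonup>\<^bsub>residuated_of_semiring S\<^esub> z)"
      by (simp add: residuated_of_semiring_def join_order_def mult_leq_iff)
  \<comment> \<open>In iterated meets the inner double \<open>\<nn>\<close> cancels by
    \<open>dnl1\<close>, so associativity of the meet reduces to that of addition.\<close>
  qed (simp_all add: residuated_of_semiring_def join_order_def dnl1 a_assoc simple
      add_meet_absorb meet_add_absorb, simp_all add: a_comm)
qed

lemma complete_residuated_lattice_residuated_of_semiring:
  "complete_residuated_lattice (residuated_of_semiring S)"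
  using residuated_lattice_residuated_of_semiring complete_lattice_semiring_order
  by (simp add: complete_residuated_lattice_def complete_residuated_lattice_axioms_def
      residuated_of_semiring_def)

text \<open>Since \<open>\<nn> \<zero> = \<one>\<close>, the negation
  \<open>\<nn> (x \<otimes> \<nn> \<zero>)\<close> is just \<open>\<nn> x\<close>, and (i)
  applies.\<close>

lemma double_negation_law_residuated_of_semiring:
  "double_negation_law (residuated_of_semiring S)"
  by (simp add: double_negation_law_def rneg_def residuated_of_semiring_def
      annihilator_sup_zero dnl1)

end

theorem theorem14:
  fixes S :: "('a, 'm) ring_scheme"
  assumes "dnl_semiring S"
  shows "complete_residuated_lattice (residuated_of_semiring S) \<and>
    double_negation_law (residuated_of_semiring S)"
  using assms dnl_semiring.complete_residuated_lattice_residuated_of_semiring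
    dnl_semiring.double_negation_law_residuated_of_semiring by blast

end
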